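(* Let $\Psi$ be a weighted directed graph with finite vertex set ${\tt N}$, let $\aleph$ be a partition of ${\tt N}$ by which $\Psi$ is tree-divisible, let $F'\in{\cal F}^k(\Psi|\aleph)$ and let $F$ be a minimal principal of $F'$. Then $F\in\tilde{\cal F}^{*k}$ if and only if $F'\in\tilde{\cal F}^k(\Psi|\aleph)$.
   Context: $\Psi$ has real arc weights $\psi_{ij}$. An entering forest is a directed graph in which at most one arc leaves each vertex and there are no directed cycles; its components are entering trees, whose root is the unique vertex with no outgoing arc. ${\cal F}^k(G)$ is the set of spanning entering forests of $G$ with exactly $k$ trees. For a subgraph $G$ of $\Psi$ and ${\tt D}\subseteq{\tt N}$, $\Upsilon^G_{\tt D}=\sum_{(i,j)\in{\tt A}G,\ i\in{\tt D}}\psi_{ij}$, $\Upsilon^G=\Upsilon^G_{\tt N}$; $G|_{\tt D}$ is the induced subgraph. For a spanning subgraph $G$ of $\Psi$ and ${\tt D}\subseteq{\tt N}$: ${\cal T}^\bullet_{\tt D}(G)$ is the set of entering trees in $G$ with vertex set ${\tt D}$, $\lambda^\bullet_{\tt D}(G)=\min_{T\in{\cal T}^\bullet_{\tt D}(G)}\Upsilon^T$; ${\cal T}^\circ_{\tt D}(G)$ is the set of entering trees $T\subseteq G$ with ${\tt D}\subset{\tt V}T$, $|{\tt V}T|=|{\tt D}|+1$, $T|_{\tt D}\in{\cal T}^\bullet_{\tt D}(G)$. For distinct ${\tt X},{\tt Y}\in\aleph$, ${\cal T}_{\tt XY}(G)$ is the set of $T\in{\cal T}^\circ_{\tt X}(G)$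 with root in ${\tt Y}$, $\lambda_{\tt XY}(G)=\min_{T\in{\cal T}_{\tt XY}(G)}\Upsilon^T$. When $G=\Psi$ the argument is omitted. $G$ is tree-divisible by $\aleph$ if ${\cal T}^\bullet_{\tt X}(G)\ne\emptyset$ for all ${\tt X}\in\aleph$. The splitting $G|\aleph=G^\aleph$ of a tree-divisible $G$ has vertex set $\aleph$ and an arc $({\tt X},{\tt Y})$, ${\tt X}\ne{\tt Y}$, iff ${\cal T}_{\tt XY}(G)\ne\emptyset$, of weight $\lambda_{\tt XY}(G)-\lambda^\bullet_{\tt X}(G)$. $\tilde{\cal F}^k(\Psi|\aleph)$ is the set of forests in ${\cal F}^k(\Psi|\aleph)$ of minimum total weight (with the arc weights of $\Psi|\aleph$). ${\cal F}^{*k}$ is the set of forests in ${\cal F}^k(\Psi)$ that are tree-divisible by $\aleph$, and $\tilde{\cal F}^{*k}$ the set of those of minimum weight $\Upsilon^F$ within ${\cal F}^{*k}$. A tree-divisible $F\in{\cal F}^k(\Psi)$ is a principal of a spanning entering forest $F'$ of $\Psi|\aleph$ if the arc set of $F'$ equals that of $F^\aleph$; a minimal principal of $F'$ is a principal of minimal weight $\Upsilon^F$ among all principals of $F'$. *)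

theory Defs
  imports "Graph_Theory.Graph_Theory" "HOL-Library.Disjoint_Sets"
begin

text \<open>
  Digraphs carry at most one arc per ordered pair of vertices, so they are modelled by
  \<^typ>\<open>'a pair_pre_digraph\<close>; the weight of an arc \<open>(i, j)\<close> is \<open>\<psi> (i, j)\<close>.
\<close>

definition pinduce :: "'a pair_pre_digraph \<Rightarrow> 'a set \<Rightarrow> 'a pair_pre_digraph" where
  "pinduce G D = \<lparr> pverts = D, parcs = {e \<in> parcs G. fst e \<in> D \<and> snd e \<in> D} \<rparr>"

lemma with_proj_pinduce: "with_proj (pinduce G D) = with_proj G \<restriction> D"
  by (simp add: pinduce_def induce_subgraph_def with_proj_def)

text \<open>The library's \<^const>\<open>forest\<close> says precisely that there is no directed cycle
  (loops included), and its notion of connectedness ignores the orientation of arcs.\<close>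

definition entering_forest :: "'a pair_pre_digraph \<Rightarrow> bool" where
  "entering_forest F \<longleftrightarrow> pair_wf_digraph F \<and> single_valued (parcs F) \<and> forest (with_proj F)"

definition components :: "'a pair_pre_digraph \<Rightarrow> 'a pair_pre_digraph set" where
  "components F = {C. pre_digraph.max_subgraph (with_proj F) Digraph_Component.connected (with_proj C)}"

definition entering_tree :: "'a pair_pre_digraph \<Rightarrow> bool" where
  "entering_tree T \<longleftrightarrow> entering_forest T \<and> Digraph_Component.connected (with_proj T)"

definition tree_root :: "'a pair_pre_digraph \<Rightarrow> 'a" where
  "tree_root T = (THE r. r \<in> pverts T \<and> (\<forall>v. (r, v) \<notin> parcs T))"

definition spanning_forests :: "nat \<Rightarrow> 'a pair_pre_digraph \<Rightarrow> 'a pair_pre_digraph set" where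
  "spanning_forests k G = {F. spanning (with_proj F) (with_proj G) \<and> entering_forest F \<and> card (components F) = k}"

definition weight_from :: "('a \<times> 'a) weight_fun \<Rightarrow> 'a set \<Rightarrow> 'a pair_pre_digraph \<Rightarrow> real" where
  "weight_from \<psi> D G = (\<Sum>e \<in> {e \<in> parcs G. fst e \<in> D}. \<psi> e)"

text \<open>
  All arcs of a well-formed \<open>G\<close> start in \<^term>\<open>pverts G\<close>, so taking \<^term>\<open>pverts G\<close> here is the
  same as taking the vertex set of any ambient digraph.
\<close>

definition weight :: "('a \<times> 'a) weight_fun \<Rightarrow> 'a pair_pre_digraph \<Rightarrow> real" where
  "weight \<psi> G = weight_from \<psi> (pverts G) G"

definition trees_on :: "'a pair_pre_digraph \<Rightarrow> 'a set \<Rightarrow> 'a pair_pre_digraph set" where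
  "trees_on G D = {T. subgraph (with_proj T) (with_proj G) \<and> entering_tree T \<and> pverts T = D}"

definition min_tree_on :: "('a \<times> 'a) weight_fun \<Rightarrow> 'a pair_pre_digraph \<Rightarrow> 'a set \<Rightarrow> real" where
  "min_tree_on \<psi> G D = Min (weight \<psi> ` trees_on G D)"

definition trees_beyond :: "'a pair_pre_digraph \<Rightarrow> 'a set \<Rightarrow> 'a pair_pre_digraph set" where
  "trees_beyond G D = {T. subgraph (with_proj T) (with_proj G) \<and> entering_tree T \<and> D \<subset> pverts T
     \<and> card (pverts T) = card D + 1 \<and> pinduce T D \<in> trees_on G D}"

definition trees_between ::
    "'a pair_pre_digraph \<Rightarrow> 'a set \<Rightarrow> 'a set \<Rightarrow> 'a pair_pre_digraph set" where
  "trees_between G X Y = {T \<in> trees_beyond G X. tree_root T \<in> Y}"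

definition min_tree_between ::
    "('a \<times> 'a) weight_fun \<Rightarrow> 'a pair_pre_digraph \<Rightarrow> 'a set \<Rightarrow> 'a set \<Rightarrow> real" where
  "min_tree_between \<psi> G X Y = Min (weight \<psi> ` trees_between G X Y)"

definition tree_divisible :: "'a pair_pre_digraph \<Rightarrow> 'a set set \<Rightarrow> bool" where
  "tree_divisible G P \<longleftrightarrow> (\<forall>X \<in> P. trees_on G X \<noteq> {})"

definition splitting :: "'a pair_pre_digraph \<Rightarrow> 'a set set \<Rightarrow> 'a set pair_pre_digraph" where
  "splitting G P = \<lparr> pverts = P,
     parcs = {(X, Y). X \<in> P \<and> Y \<in> P \<and> X \<noteq> Y \<and> trees_between G X Y \<noteq> {}} \<rparr>"

text \<open>Meaningful only on the arcs of the splitting, where both minima are over nonempty sets.\<close>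

definition splitting_weight ::
    "('a \<times> 'a) weight_fun \<Rightarrow> 'a pair_pre_digraph \<Rightarrow> ('a set \<times> 'a set) weight_fun" where
  "splitting_weight \<psi> G = (\<lambda>(X, Y). min_tree_between \<psi> G X Y - min_tree_on \<psi> G X)"

definition min_weight_in ::
    "('a \<times> 'a) weight_fun \<Rightarrow> 'a pair_pre_digraph set \<Rightarrow> 'a pair_pre_digraph set" where
  "min_weight_in \<psi> S = {F. is_arg_min (weight \<psi>) (\<lambda>H. H \<in> S) F}"

definition divisible_forests ::
    "nat \<Rightarrow> 'a pair_pre_digraph \<Rightarrow> 'a set set \<Rightarrow> 'a pair_pre_digraph set" where
  "divisible_forests k \<Psi> P = {F \<in> spanning_forests k \<Psi>. tree_divisible F P}"

definition principals ::
    "'a pair_pre_digraph \<Rightarrow> 'a set set \<Rightarrow> 'a set pair_pre_digraph \<Rightarrow> 'a pair_pre_digraph set" where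
  "principals \<Psi> P F' =
     {F. (\<exists>k. F \<in> spanning_forests k \<Psi>) \<and> tree_divisible F P \<and> parcs F' = parcs (splitting F P)}"

end

theory Submission
  imports Defs
begin

text \<open>
  In a forest \<open>F\<close> that is tree-divisible by the partition \<open>P\<close>, every block \<open>X\<close> induces an entering
  tree, and an arc can leave \<open>X\<close> only from the root of that tree. Hence \<open>F\<close> is made of one tree per
  block together with at most one arc leaving each block; contracting the blocks yields the
  splitting, which is a forest with as many sinks (that is, trees) as \<open>F\<close>. Comparing block by block,
  the weight of \<open>F\<close> is at least \<open>c\<close> plus the weight of its splitting, where \<open>c\<close> is the sum of the
  minimal tree weights of the blocks. Conversely, gluing optimal trees along any forest of
  \<open>splitting \<Psi> P\<close> gives a principal attaining this bound. So a minimal principal of \<open>F'\<close> weighs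
  exactly \<open>c\<close> more than \<open>F'\<close>, and minimality on either side is the same condition.
\<close>

section \<open>Entering forests and their sinks\<close>

text \<open>A nonempty closed walk contains a cycle and every cycle is such a walk, so acyclicity
  can be handled through transitive closures of arc sets instead of walks.\<close>

lemma forest_iff_acyclic:
  assumes "pair_wf_digraph G"
  shows "forest (with_proj G) \<longleftrightarrow> acyclic (parcs G)"
proof -
  interpret pair_wf_digraph G by fact
  show ?thesis
  proof
    assume "forest (with_proj G)"
    then show "acyclic (parcs G)"
      using closed_w_imp_cycle reachable1_awalk
      by (auto simp: forest_def acyclic_def closed_w_def)
  next
    assume "acyclic (parcs G)"
    then show "forest (with_proj G)"
      using reachable1_awalk by (auto simp: forest_def acyclic_def cycle_def)
  qed
qed

lemma entering_forest_iff:
  "entering_forest F \<longleftrightarrow> pair_wf_digraph F \<and> single_valued (parcs F) \<and> acyclic (parcs F)"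
  by (auto simp: entering_forest_def forest_iff_acyclic)

text \<open>Turns connectedness into reachability in the symmetric closure of the arcs, a form
  suited to induction along undirected steps.\<close>

lemma connected_iff:
  assumes "pair_wf_digraph G"
  shows "Digraph_Component.connected (with_proj G) \<longleftrightarrow>
    pverts G \<noteq> {} \<and> (\<forall>u \<in> pverts G. \<forall>v \<in> pverts G. (u, v) \<in> (parcs G \<union> (parcs G)\<inverse>)\<^sup>*)"
proof -
  interpret pair_wf_digraph G by fact
  interpret S: pair_wf_digraph "mk_symmetric (with_proj G)"
    by (rule wellformed_mk_symmetric)
  have "parcs (mk_symmetric (with_proj G)) = parcs G \<union> (parcs G)\<inverse>"
    by (force simp: parcs_mk_symmetric)
  then show ?thesis
    using S.reachable_conv'
    by (auto simp: Digraph_Component.connected_def strongly_connected_def)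
qed

lemma subgraph_with_proj_iff:
  "subgraph (with_proj H) (with_proj G) \<longleftrightarrow>
    pverts H \<subseteq> pverts G \<and> parcs H \<subseteq> parcs G \<and> pair_wf_digraph G \<and> pair_wf_digraph H"
  by (auto simp: subgraph_def wf_digraph_wp_iff)

lemma pinduce_simps [simp]:
  "pverts (pinduce G D) = D"
  "parcs (pinduce G D) = {e \<in> parcs G. fst e \<in> D \<and> snd e \<in> D}"
  by (simp_all add: pinduce_def)

lemma pair_wf_digraph_pinduce: "pair_wf_digraph (pinduce G D)"
  by unfold_locales auto

lemma entering_forest_pinduce:
  "entering_forest F \<Longrightarrow> entering_forest (pinduce F D)"
  by (auto simp: entering_forest_iff pair_wf_digraph_pinduce
      intro: single_valued_subset acyclic_subset)

definition sinks :: "'a pair_pre_digraph \<Rightarrow> 'a set" where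
  "sinks G = {r \<in> pverts G. \<forall>v. (r, v) \<notin> parcs G}"

lemma sinks_subset: "sinks G \<subseteq> pverts G"
  by (auto simp: sinks_def)

text \<open>Following arcs must stop, since the converse of a finite acyclic relation is
  well-founded.\<close>

lemma ex_sink:
  assumes "entering_forest F" "finite (pverts F)" "v \<in> pverts F"
  obtains r where "r \<in> sinks F" "(v, r) \<in> (parcs F)\<^sup>*"
proof -
  interpret pair_wf_digraph F using assms by (simp add: entering_forest_iff)
  have "parcs F \<subseteq> pverts F \<times> pverts F" using wellformed' by auto
  then have "finite (parcs F)" using assms(2) by (meson finite_SigmaI finite_subset)
  then have "wf ((parcs F)\<inverse>)"
    using assms(1) by (simp add: entering_forest_iff finite_acyclic_wf_converse)
  then have "v \<in> pverts F \<longrightarrow> (\<exists>r \<in> sinks F. (v, r) \<in> (parcs F)\<^sup>*)"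
  proof (induction v rule: wf_induct_rule)
    case (less v)
    show ?case
    proof (cases "v \<in> sinks F")
      case False
      show ?thesis
      proof
        assume "v \<in> pverts F"
        with False obtain w where "(v, w) \<in> parcs F" by (auto simp: sinks_def)
        with less show "\<exists>r \<in> sinks F. (v, r) \<in> (parcs F)\<^sup>*"
          using wellformed' by (meson converseI converse_rtrancl_into_rtrancl)
      qed
    qed blast
  qed
  with assms(3) that show ?thesis by blast
qed

lemma sink_rtrancl_eq:
  assumes "r \<in> sinks F" "(r, v) \<in> (parcs F)\<^sup>*"
  shows "v = r"
  using assms(2,1) by (cases rule: converse_rtranclE) (auto simp: sinks_def)

text \<open>Reaching \<open>r\<close> is invariant under undirected steps. A forward arc is the only
  arc at its tail, hence the first step of the path to \<open>r\<close>; a backward arc prolongs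
  that path.\<close>

lemma connected_to_sink:
  assumes "single_valued (parcs F)" "r \<in> sinks F" "(u, r) \<in> (parcs F)\<^sup>*"
    and "(u, v) \<in> (parcs F \<union> (parcs F)\<inverse>)\<^sup>*"
  shows "(v, r) \<in> (parcs F)\<^sup>*"
  using assms(4)
proof (induction rule: rtrancl_induct)
  case base
  show ?case by fact
next
  case (step y z)
  show ?case
  proof (cases "(y, z) \<in> parcs F")
    case True
    with assms(2) have "y \<noteq> r" by (auto simp: sinks_def)
    with step.IH obtain w where "(y, w) \<in> parcs F" "(w, r) \<in> (parcs F)\<^sup>*"
      by (auto elim: converse_rtranclE)
    with True assms(1) show ?thesis by (auto dest: single_valuedD)
  next
    case False
    with step.hyps step.IH show ?thesis by (auto intro: converse_rtrancl_into_rtrancl)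
  qed
qed

text \<open>Every vertex reaches some sink, and by \<open>connected_to_sink\<close> vertices
  connected to each other reach the same one. Connectedness thus reduces to having a single sink,
  the root.\<close>

lemma entering_tree_iff:
  assumes "finite (pverts T)"
  shows "entering_tree T \<longleftrightarrow> entering_forest T \<and> (\<exists>r. sinks T = {r})"
proof (cases "entering_forest T")
  case True
  then have wf: "pair_wf_digraph T" and sv: "single_valued (parcs T)"
    by (auto simp: entering_forest_iff)
  have "Digraph_Component.connected (with_proj T) \<longleftrightarrow> (\<exists>r. sinks T = {r})"
  proof
    assume con: "Digraph_Component.connected (with_proj T)"
    then obtain v where "v \<in> pverts T" using wf by (auto simp: connected_iff)
    then obtain r where r: "r \<in> sinks T" using ex_sink[OF True assms] by blast
    have "s = r" if "s \<in> sinks T" for s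
    proof -
      have "(r, s) \<in> (parcs T \<union> (parcs T)\<inverse>)\<^sup>*"
        using con wf r that sinks_subset[of T] by (auto simp: connected_iff)
      then have "(s, r) \<in> (parcs T)\<^sup>*"
        using connected_to_sink[OF sv r] by blast
      with that show ?thesis using sink_rtrancl_eq by metis
    qed
    with r show "\<exists>r. sinks T = {r}" by blast
  next
    assume "\<exists>r. sinks T = {r}"
    then obtain r where r: "sinks T = {r}" ..
    have reach: "(v, r) \<in> (parcs T)\<^sup>*" if "v \<in> pverts T" for v
      using ex_sink[OF True assms that] r by auto
    have "(u, v) \<in> (parcs T \<union> (parcs T)\<inverse>)\<^sup>*" if "u \<in> pverts T" "v \<in> pverts T" for u v
    proof -
      have "(u, r) \<in> (parcs T \<union> (parcs T)\<inverse>)\<^sup>*"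
        using reach[OF that(1)] in_rtrancl_UnI by blast
      moreover have "(r, v) \<in> (parcs T \<union> (parcs T)\<inverse>)\<^sup>*"
        using reach[OF that(2)] in_rtrancl_UnI by (metis converseI rtrancl_converse)
      ultimately show ?thesis by simp
    qed
    moreover have "pverts T \<noteq> {}" using r sinks_subset[of T] by blast
    ultimately show "Digraph_Component.connected (with_proj T)"
      using wf by (simp add: connected_iff)
  qed
  with True show ?thesis by (simp add: entering_tree_def)
qed (simp add: entering_tree_def)

lemma tree_root_eq: "sinks T = {r} \<Longrightarrow> tree_root T = r"
  unfolding tree_root_def sinks_def by (rule the_equality) auto

text \<open>For a sink \<open>r\<close> of a finite entering forest this is the vertex set of the
  component rooted at \<open>r\<close>.\<close>

definition basin :: "'a pair_pre_digraph \<Rightarrow> 'a \<Rightarrow> 'a set" where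
  "basin F r = {v \<in> pverts F. (v, r) \<in> (parcs F)\<^sup>*}"

lemma entering_tree_basin:
  assumes "entering_forest F" "finite (pverts F)" "r \<in> sinks F"
  shows "entering_tree (pinduce F (basin F r))"
proof -
  interpret pair_wf_digraph F using assms by (simp add: entering_forest_iff)
  have fin: "finite (basin F r)" using assms(2) by (simp add: basin_def)
  have "sinks (pinduce F (basin F r)) = {r}"
  proof
    show "{r} \<subseteq> sinks (pinduce F (basin F r))"
      using assms(3) by (auto simp: sinks_def basin_def)
    show "sinks (pinduce F (basin F r)) \<subseteq> {r}"
    proof
      fix s assume s: "s \<in> sinks (pinduce F (basin F r))"
      then have "(s, r) \<in> (parcs F)\<^sup>*" "s \<in> basin F r" by (auto simp: sinks_def basin_def)
      then show "s \<in> {r}"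
      proof (cases rule: converse_rtranclE)
        case (step y)
        then have "y \<in> basin F r" using wellformed' by (auto simp: basin_def)
        with step s \<open>s \<in> basin F r\<close> show ?thesis by (auto simp: sinks_def)
      qed simp
    qed
  qed
  then show ?thesis
    using assms(1) fin by (simp add: entering_tree_iff entering_forest_pinduce)
qed

text \<open>A connected subgraph cannot straddle two basins, because reaching \<open>r\<close> is
  invariant under its undirected steps. This supplies the maximality that singles out
  components.\<close>

lemma connected_subgraph_basin:
  assumes F: "entering_forest F" "finite (pverts F)"
    and sub: "subgraph (with_proj C) (with_proj F)"
    and con: "Digraph_Component.connected (with_proj C)"
    and v: "v \<in> pverts C" and r: "r \<in> sinks F" "v \<in> basin F r"
  shows "subgraph (with_proj C) (with_proj (pinduce F (basin F r)))"
proof -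
  have wfC: "pair_wf_digraph C" and CF: "pverts C \<subseteq> pverts F" "parcs C \<subseteq> parcs F"
    using sub by (auto simp: subgraph_with_proj_iff)
  have "(w, r) \<in> (parcs F)\<^sup>*" if "w \<in> pverts C" for w
  proof -
    have "(v, w) \<in> (parcs C \<union> (parcs C)\<inverse>)\<^sup>*"
      using con wfC v that by (simp add: connected_iff)
    moreover have "parcs C \<union> (parcs C)\<inverse> \<subseteq> parcs F \<union> (parcs F)\<inverse>" using CF by blast
    ultimately have "(v, w) \<in> (parcs F \<union> (parcs F)\<inverse>)\<^sup>*" using rtrancl_mono by blast
    then show ?thesis
      using connected_to_sink F(1) r by (auto simp: entering_forest_iff basin_def)
  qed
  then have "pverts C \<subseteq> basin F r" using CF by (auto simp: basin_def)
  then show ?thesis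
    using CF wfC pair_wf_digraph_pinduce
    by (auto simp: subgraph_with_proj_iff
        dest: pair_wf_digraph.wellformed')
qed

lemma components_eq:
  assumes "entering_forest F" "finite (pverts F)"
  shows "components F = (\<lambda>r. pinduce F (basin F r)) ` sinks F"
proof -
  interpret pair_wf_digraph F using assms by (simp add: entering_forest_iff)
  have sub: "subgraph (with_proj (pinduce F (basin F r))) (with_proj F)" for r
    using pair_wf_digraph_axioms pair_wf_digraph_pinduce
    by (auto simp: subgraph_with_proj_iff basin_def)
  have con: "Digraph_Component.connected (with_proj (pinduce F (basin F r)))" if "r \<in> sinks F" for r
    using entering_tree_basin[OF assms that] by (simp add: entering_tree_def)
  have antisym: "A = B" if "subgraph (with_proj A) (with_proj B)" "subgraph (with_proj B) (with_proj A)"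
    for A B :: "'a pair_pre_digraph"
    using that by (auto simp: subgraph_with_proj_iff intro!: pair_pre_digraph.equality)
  show ?thesis
  proof (intro equalityI subsetI)
    fix C assume "C \<in> components F"
    then have C: "subgraph (with_proj C) (with_proj F)" "Digraph_Component.connected (with_proj C)"
      and max: "\<And>H. H \<noteq> with_proj C \<Longrightarrow> subgraph (with_proj C) H \<Longrightarrow>
        \<not> (subgraph H (with_proj F) \<and> Digraph_Component.connected H)"
      by (auto simp: components_def max_subgraph_def)
    from C have "pverts C \<noteq> {}" by (auto simp: connected_iff subgraph_with_proj_iff)
    then obtain v where v: "v \<in> pverts C" by blast
    with C have vF: "v \<in> pverts F" by (auto simp: subgraph_with_proj_iff)
    then obtain r where r: "r \<in> sinks F" "v \<in> basin F r"
      using ex_sink[OF assms] by (auto simp: basin_def)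
    have CB: "subgraph (with_proj C) (with_proj (pinduce F (basin F r)))"
      using connected_subgraph_basin[OF assms C v r] .
    then have "with_proj (pinduce F (basin F r)) = with_proj C"
      using max sub con[OF r(1)] by blast
    then have "C = pinduce F (basin F r)"
      by (metis CB antisym)
    with r show "C \<in> (\<lambda>r. pinduce F (basin F r)) ` sinks F" by blast
  next
    fix C assume "C \<in> (\<lambda>r. pinduce F (basin F r)) ` sinks F"
    then obtain r where r: "r \<in> sinks F" and C: "C = pinduce F (basin F r)" by blast
    have rC: "r \<in> basin F r" using r sinks_subset[of F] by (auto simp: basin_def)
    have "H = with_proj C"
      if H: "subgraph (with_proj C) H" "subgraph H (with_proj F)" "Digraph_Component.connected H" for H
    proof -
      \<comment> \<open>\<open>max_subgraph\<close> ranges over arbitrary digraphs \<open>H\<close>.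
        Compatibility with \<open>with_proj F\<close> forces the tail and head maps of
        \<open>H\<close> to be the projections, so \<open>H\<close> comes from a pair
        digraph.\<close>
      define K where "K = \<lparr>pverts = verts H, parcs = arcs H\<rparr>"
      have HK: "H = with_proj K"
        using H(2) by (auto simp: K_def with_proj_def subgraph_def compatible_def
            intro!: pre_digraph.equality)
      have "r \<in> pverts K" using H(1) rC C by (auto simp: HK subgraph_with_proj_iff)
      then have "subgraph (with_proj K) (with_proj C)"
        using connected_subgraph_basin[OF assms _ _ _ r rC, of K] H C by (simp add: HK)
      then show ?thesis using antisym H(1) HK by blast
    qed
    then show "C \<in> components F"
      using sub con[OF r] C by (auto simp: components_def max_subgraph_def)
  qed
qed

text \<open>Distinct sinks have distinct basins, as a sink reaches only itself. From here on the
  number of trees is counted by sinks.\<close>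

lemma card_components:
  assumes "entering_forest F" "finite (pverts F)"
  shows "card (components F) = card (sinks F)"
proof -
  have "inj_on (\<lambda>r. pinduce F (basin F r)) (sinks F)"
  proof
    fix r s assume rs: "r \<in> sinks F" "s \<in> sinks F" "pinduce F (basin F r) = pinduce F (basin F s)"
    then have "basin F r = basin F s" by (metis pinduce_simps(1))
    then have "r \<in> basin F s" using rs(1) sinks_subset[of F] by (auto simp: basin_def)
    then show "r = s" using sink_rtrancl_eq[OF rs(1)] by (auto simp: basin_def)
  qed
  then show ?thesis by (simp add: components_eq[OF assms] card_image)
qed

section \<open>Trees on a vertex set and one vertex beyond it\<close>

lemma trees_onE:
  assumes "S \<in> trees_on G X" "finite X"
  obtains r where "sinks S = {r}" "r \<in> X" "pverts S = X" "parcs S \<subseteq> parcs G" "pair_wf_digraph S"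
    "single_valued (parcs S)" "acyclic (parcs S)" "pair_wf_digraph G" "X \<subseteq> pverts G"
    "parcs S \<subseteq> X \<times> X"
proof -
  have S: "pverts S = X" "entering_tree S" "subgraph (with_proj S) (with_proj G)"
    using assms by (auto simp: trees_on_def)
  then obtain r where r: "sinks S = {r}" using assms(2) by (auto simp: entering_tree_iff)
  have "entering_forest S" using S by (simp add: entering_tree_def)
  moreover from this have "parcs S \<subseteq> X \<times> X"
    using S(1) by (auto simp: entering_forest_iff dest: pair_wf_digraph.wellformed')
  ultimately show thesis
    using that[OF r] S r sinks_subset[of S] by (auto simp: subgraph_with_proj_iff entering_forest_iff)
qed

text \<open>Intended for an arc from the root of \<open>S\<close> to a vertex outside
  \<open>S\<close>; its head then becomes the new root.\<close>

definition attach :: "'a pair_pre_digraph \<Rightarrow> 'a \<times> 'a \<Rightarrow> 'a pair_pre_digraph" where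
  "attach S e = \<lparr>pverts = insert (snd e) (pverts S), parcs = insert e (parcs S)\<rparr>"

lemma attach_simps [simp]:
  "pverts (attach S e) = insert (snd e) (pverts S)"
  "parcs (attach S e) = insert e (parcs S)"
  by (simp_all add: attach_def)

text \<open>No arc of \<open>S\<close> starts at \<open>v\<close>, so the new arc closes no cycle;
  it takes the place of the missing arc at \<open>r\<close> and leaves \<open>v\<close> as the only
  sink.\<close>

lemma attach_in_trees_between:
  assumes "finite X" "X \<inter> Y = {}"
    and S: "S \<in> trees_on G X" "sinks S = {r}" and v: "v \<in> Y" "(r, v) \<in> parcs G"
  shows "attach S (r, v) \<in> trees_between G X Y"
proof -
  obtain "r \<in> X" and pv: "pverts S = X" and SG: "parcs S \<subseteq> parcs G" and wfS: "pair_wf_digraph S"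
    and sv: "single_valued (parcs S)" and ac: "acyclic (parcs S)"
    and wfG: "pair_wf_digraph G" and XG: "X \<subseteq> pverts G" and SX: "parcs S \<subseteq> X \<times> X"
    using trees_onE[OF S(1) assms(1)] S(2) by (metis singleton_inject)
  have vX: "v \<notin> X" using v(1) assms(2) by blast
  let ?T = "attach S (r, v)"
  have wfT: "pair_wf_digraph ?T"
    using \<open>r \<in> X\<close> SX pv by unfold_locales auto
  have svT: "single_valued (parcs ?T)"
    using sv S(2) by (auto simp: single_valued_def sinks_def)
  have "(v, r) \<notin> (parcs S)\<^sup>*"
  proof
    assume "(v, r) \<in> (parcs S)\<^sup>*"
    then show False using vX \<open>r \<in> X\<close> SX by (cases rule: converse_rtranclE) auto
  qed
  then have acT: "acyclic (parcs ?T)" using ac by (simp add: acyclic_insert)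
  have sinksT: "sinks ?T = {v}"
  proof -
    have "u \<in> {r}" if "u \<in> X" "\<forall>w. (u, w) \<notin> parcs S" for u
      using that pv by (auto simp: S(2)[symmetric] sinks_def)
    then show ?thesis using pv vX SX \<open>r \<in> X\<close> by (auto simp: sinks_def)
  qed
  have "pinduce ?T X = S"
    using pv vX SX by (auto intro!: pair_pre_digraph.equality)
  moreover have "entering_tree ?T"
    using wfT svT acT sinksT pv assms(1) by (simp add: entering_tree_iff entering_forest_iff)
  moreover have "v \<in> pverts G" using wfG v(2) by (rule pair_wf_digraph.in_arcsD2)
  ultimately show ?thesis
    using S(1) wfT wfG XG SG v pv vX assms(1) tree_root_eq[OF sinksT]
    by (auto simp: trees_between_def trees_beyond_def subgraph_with_proj_iff)
qed

text \<open>The root lies in \<open>Y\<close>, hence outside \<open>X\<close>, so it is the single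
  extra vertex \<open>v\<close>. A vertex with an arc to \<open>v\<close> has no arc inside
  \<open>X\<close> and is therefore the root of the induced tree.\<close>

lemma trees_betweenE:
  assumes T: "T \<in> trees_between G X Y" and "finite X" "X \<inter> Y = {}"
  obtains S r v where "S \<in> trees_on G X" "sinks S = {r}" "v \<in> Y" "(r, v) \<in> parcs G"
    "T = attach S (r, v)"
proof -
  define S where "S = pinduce T X"
  have S: "S \<in> trees_on G X" and XT: "X \<subset> pverts T" and cT: "card (pverts T) = card X + 1"
    and tree: "entering_tree T" and TG: "parcs T \<subseteq> parcs G"
    and root: "tree_root T \<in> Y"
    using T by (auto simp: trees_between_def trees_beyond_def S_def subgraph_with_proj_iff)
  \<comment> \<open>An infinite set has \<open>card\<close> equal to 0, which cannot be
    \<open>card X + 1\<close>.\<close>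
  have finT: "finite (pverts T)" using cT by (metis add_is_0 card.infinite one_neq_zero)
  have "card (pverts T - X) = 1" using cT XT assms(2) by (simp add: card_Diff_subset psubset_imp_subset)
  then obtain v where "pverts T - X = {v}" by (metis card_1_singletonE)
  then have pT: "pverts T = insert v X" and vX: "v \<notin> X" using XT by auto
  obtain t where t: "sinks T = {t}" and ef: "entering_forest T"
    using tree finT by (auto simp: entering_tree_iff)
  have "t \<in> Y" using root tree_root_eq[OF t] by simp
  then have "t = v" using t pT sinks_subset[of T] assms(3) by auto
  obtain r where r: "sinks S = {r}" "r \<in> X"
    using trees_onE[OF S assms(2)] by metis
  have sv: "single_valued (parcs T)" and wfT: "pair_wf_digraph T"
    using ef by (auto simp: entering_forest_iff)
  have noarc: "(v, w) \<notin> parcs T" for w using t \<open>t = v\<close> by (auto simp: sinks_def)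
  have leave: "i = r" if "(i, v) \<in> parcs T" for i
  proof -
    have "i \<in> pverts T" using pair_wf_digraph.in_arcsD1[OF wfT that] .
    then have "i \<in> X" using that noarc pT by auto
    moreover have "(i, w) \<notin> parcs S" for w
      using that vX sv by (auto simp: S_def dest: single_valuedD)
    ultimately have "i \<in> sinks S" by (auto simp: sinks_def S_def)
    with r show ?thesis by simp
  qed
  have "r \<notin> sinks T" using t \<open>t = v\<close> r vX by auto
  then obtain w where w: "(r, w) \<in> parcs T" using r pT by (auto simp: sinks_def)
  moreover have "w \<notin> X"
    using w r by (auto simp: sinks_def S_def)
  moreover have "w \<in> pverts T" using pair_wf_digraph.in_arcsD2[OF wfT w] .
  ultimately have rv: "(r, v) \<in> parcs T" using pT by auto
  have "parcs T = insert (r, v) (parcs S)"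
  proof (intro equalityI subrelI)
    fix i j assume ij: "(i, j) \<in> parcs T"
    then have "i \<in> pverts T" "j \<in> pverts T"
      using wfT by (auto dest: pair_wf_digraph.wellformed')
    then have "i \<in> X" "j \<in> insert v X" using ij noarc pT by auto
    then show "(i, j) \<in> insert (r, v) (parcs S)"
      using ij leave by (auto simp: S_def)
  qed (use rv in \<open>auto simp: S_def\<close>)
  then have "T = attach S (r, v)"
    using pT by (auto simp: S_def intro!: pair_pre_digraph.equality)
  then show thesis using that S r rv TG \<open>t \<in> Y\<close> \<open>t = v\<close> by blast
qed

section \<open>Finiteness of the sets of trees, and additivity of weights\<close>

lemma finite_digraphs_within:
  assumes "finite A" "finite B"
  shows "finite {T :: 'a pair_pre_digraph. pverts T \<subseteq> A \<and> parcs T \<subseteq> B}"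
proof (rule finite_imageD)
  show "finite ((\<lambda>T. (pverts T, parcs T)) ` {T :: 'a pair_pre_digraph. pverts T \<subseteq> A \<and> parcs T \<subseteq> B})"
    by (rule finite_subset[of _ "Pow A \<times> Pow B"]) (use assms in auto)
  show "inj_on (\<lambda>T. (pverts T, parcs T)) {T :: 'a pair_pre_digraph. pverts T \<subseteq> A \<and> parcs T \<subseteq> B}"
    by (rule inj_onI) (auto intro!: pair_pre_digraph.equality)
qed

lemma finite_trees_on:
  assumes "pair_fin_digraph G"
  shows "finite (trees_on G X)"
proof -
  interpret pair_fin_digraph G by fact
  show ?thesis
    by (rule finite_subset[OF _ finite_digraphs_within[OF pair_finite_verts pair_finite_arcs]])
      (auto simp: trees_on_def subgraph_with_proj_iff)
qed

lemma finite_trees_between: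
  assumes "pair_fin_digraph G"
  shows "finite (trees_between G X Y)"
proof -
  interpret pair_fin_digraph G by fact
  show ?thesis
    by (rule finite_subset[OF _ finite_digraphs_within[OF pair_finite_verts pair_finite_arcs]])
      (auto simp: trees_between_def trees_beyond_def subgraph_with_proj_iff)
qed

lemma trees_between_mono:
  assumes "subgraph (with_proj F) (with_proj G)"
  shows "trees_between F X Y \<subseteq> trees_between G X Y"
  using assms by (auto simp: trees_between_def trees_beyond_def trees_on_def intro: subgraph_trans)

lemma weight_eq_sum:
  assumes "pair_wf_digraph G"
  shows "weight \<psi> G = sum \<psi> (parcs G)"
  using assms unfolding weight_def weight_from_def
  by (intro arg_cong[where f = "sum \<psi>"]) (auto dest: pair_wf_digraph.wellformed')

text \<open>Each arc is charged to the block that contains its tail.\<close>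

lemma weight_eq_sum_blocks:
  assumes "pair_wf_digraph G" "finite (pverts G)" "partition_on (pverts G) P"
  shows "weight \<psi> G = (\<Sum>D\<in>P. weight_from \<psi> D G)"
proof -
  interpret pair_wf_digraph G by fact
  have "parcs G \<subseteq> pverts G \<times> pverts G" using wellformed' by auto
  then have fin: "finite (parcs G)" using assms(2) by (meson finite_SigmaI finite_subset)
  have "parcs G = (\<Union>D\<in>P. {e \<in> parcs G. fst e \<in> D})"
    using partition_onD1[OF assms(3)] arc_fst_in_verts by auto
  moreover have "finite P" using assms(2,3) finite_elements by blast
  moreover have "\<forall>D\<in>P. \<forall>E\<in>P. D \<noteq> E \<longrightarrow>
      {e \<in> parcs G. fst e \<in> D} \<inter> {e \<in> parcs G. fst e \<in> E} = {}"
    using assms(3) by (fastforce simp: partition_on_def disjoint_def)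
  ultimately have "sum \<psi> (parcs G) = (\<Sum>D\<in>P. sum \<psi> {e \<in> parcs G. fst e \<in> D})"
    using fin sum.UNION_disjoint[of P "\<lambda>D. {e \<in> parcs G. fst e \<in> D}" \<psi>] by simp
  then show ?thesis by (simp add: weight_eq_sum[OF assms(1)] weight_from_def)
qed

text \<open>This is the partition into singletons. The vertices of a splitting are the blocks, so
  its weight becomes a sum over the same index set as in \<open>weight_eq_sum_blocks\<close> and can
  be compared term by term.\<close>

lemma weight_eq_sum_vertices:
  assumes "pair_wf_digraph G" "finite (pverts G)"
  shows "weight \<psi> G = (\<Sum>v\<in>pverts G. weight_from \<psi> {v} G)"
proof -
  have "partition_on (pverts G) ((\<lambda>v. {v}) ` pverts G)"
    by (auto simp: partition_on_def disjoint_def)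
  then have "weight \<psi> G = (\<Sum>D\<in>(\<lambda>v. {v}) ` pverts G. weight_from \<psi> D G)"
    by (rule weight_eq_sum_blocks[OF assms])
  then show ?thesis by (simp add: sum.reindex)
qed

lemma splitting_simps [simp]:
  "pverts (splitting G P) = P"
  "parcs (splitting G P) = {(X, Y). X \<in> P \<and> Y \<in> P \<and> X \<noteq> Y \<and> trees_between G X Y \<noteq> {}}"
  by (simp_all add: splitting_def)

lemma pair_wf_digraph_splitting: "pair_wf_digraph (splitting G P)"
  by unfold_locales auto

section \<open>Forests composed of trees on the blocks\<close>

text \<open>Acyclicity of \<open>F\<close> as a whole is not assumed, only that of its blocks: it is equivalent to
  acyclicity of the splitting, which is used in one direction for a given forest and in the
  other one for a graph assembled from trees.\<close>

locale tree_blocks = pair_wf_digraph F for F :: "'a pair_pre_digraph" +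
  fixes P :: "'a set set" and \<rho> :: "'a set \<Rightarrow> 'a"
  assumes fin: "finite (pverts F)"
    and part: "partition_on (pverts F) P"
    and sv: "single_valued (parcs F)"
    and ac_block: "X \<in> P \<Longrightarrow> acyclic (parcs (pinduce F X))"
    and root: "X \<in> P \<Longrightarrow> sinks (pinduce F X) = {\<rho> X}"
begin

lemma root_in: "X \<in> P \<Longrightarrow> \<rho> X \<in> X"
  using root sinks_subset by fastforce

lemma block_disjoint: "X \<in> P \<Longrightarrow> Y \<in> P \<Longrightarrow> X \<noteq> Y \<Longrightarrow> X \<inter> Y = {}"
  using part by (auto simp: partition_on_def disjoint_def)

lemma block_subset: "X \<in> P \<Longrightarrow> X \<subseteq> pverts F"
  using part by (auto simp: partition_on_def)

lemma finite_block: "X \<in> P \<Longrightarrow> finite X"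
  using block_subset fin finite_subset by blast

lemma block_of:
  assumes "v \<in> pverts F"
  obtains X where "X \<in> P" "v \<in> X"
  using assms part by (auto simp: partition_on_def)

lemma not_root_arc:
  assumes "X \<in> P" "i \<in> X" "i \<noteq> \<rho> X"
  obtains j where "(i, j) \<in> parcs F" "j \<in> X"
proof -
  have "i \<notin> sinks (pinduce F X)" using assms root by simp
  then show thesis using assms that by (auto simp: sinks_def)
qed

text \<open>A vertex other than the root already spends its only arc inside the block, whereas the
  root is a sink of the induced graph.\<close>

lemma leaving_arc_iff:
  assumes "X \<in> P" "i \<in> X" "(i, j) \<in> parcs F"
  shows "j \<notin> X \<longleftrightarrow> i = \<rho> X"
proof
  assume "j \<notin> X"
  then show "i = \<rho> X" using not_root_arc[OF assms(1,2)] assms(3) sv by (metis single_valuedD)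
next
  assume "i = \<rho> X"
  then have "i \<in> sinks (pinduce F X)" using root assms(1) by simp
  then show "j \<notin> X" using assms by (auto simp: sinks_def)
qed

lemma entering_forest_block: "X \<in> P \<Longrightarrow> entering_forest (pinduce F X)"
  using ac_block sv by (auto simp: entering_forest_iff pair_wf_digraph_pinduce
      intro: single_valued_subset)

text \<open>\<open>F\<close> leaves no choice of a tree: \<open>\<rho> X\<close> has no arc inside
  the block, so it is the root of any such tree, and every other vertex needs an outgoing arc, which
  can only be its unique arc in \<open>F\<close>.\<close>

lemma trees_on_block:
  assumes "X \<in> P"
  shows "trees_on F X = {pinduce F X}"
proof (intro equalityI subsetI)
  fix S assume "S \<in> trees_on F X"
  then obtain s where s: "sinks S = {s}" "pverts S = X" "parcs S \<subseteq> parcs F" "parcs S \<subseteq> X \<times> X"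
    using trees_onE finite_block[OF assms] by metis
  have "\<rho> X \<in> sinks (pinduce F X)" using root assms by simp
  then have "\<rho> X \<in> sinks S" using s by (auto simp: sinks_def)
  then have sr: "sinks S = {\<rho> X}" using s(1) by auto
  have "parcs (pinduce F X) \<subseteq> parcs S"
  proof (intro subrelI)
    fix i j assume ij: "(i, j) \<in> parcs (pinduce F X)"
    then have "i \<noteq> \<rho> X" using leaving_arc_iff assms by auto
    then have "i \<notin> sinks S" using sr by simp
    then obtain l where "(i, l) \<in> parcs S" using ij s(2) by (auto simp: sinks_def)
    then show "(i, j) \<in> parcs S" using ij s(3) sv by (auto dest: single_valuedD)
  qed
  then show "S \<in> {pinduce F X}" using s by (auto intro!: pair_pre_digraph.equality)
next
  fix S assume "S \<in> {pinduce F X}"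
  then show "S \<in> trees_on F X"
    using assms root[OF assms] entering_forest_block[OF assms] block_subset finite_block
      pair_wf_digraph_axioms pair_wf_digraph_pinduce
    by (auto simp: trees_on_def subgraph_with_proj_iff entering_tree_iff)
qed

text \<open>A tree between two blocks is a tree on the first one with an arc attached at its root,
  and that tree is the induced one by \<open>trees_on_block\<close>.\<close>

lemma splitting_arc_iff:
  "(X, Y) \<in> parcs (splitting F P) \<longleftrightarrow>
    X \<in> P \<and> Y \<in> P \<and> X \<noteq> Y \<and> (\<exists>v \<in> Y. (\<rho> X, v) \<in> parcs F)"
proof -
  have "trees_between F X Y \<noteq> {} \<longleftrightarrow> (\<exists>v \<in> Y. (\<rho> X, v) \<in> parcs F)"
    if XY: "X \<in> P" "Y \<in> P" "X \<noteq> Y"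
  proof
    assume "trees_between F X Y \<noteq> {}"
    then obtain T where "T \<in> trees_between F X Y" by blast
    then obtain S r v where "S \<in> trees_on F X" "sinks S = {r}" "v \<in> Y" "(r, v) \<in> parcs F"
      using trees_betweenE finite_block block_disjoint XY by metis
    then show "\<exists>v \<in> Y. (\<rho> X, v) \<in> parcs F"
      using trees_on_block root XY by auto
  next
    assume "\<exists>v \<in> Y. (\<rho> X, v) \<in> parcs F"
    then show "trees_between F X Y \<noteq> {}"
      using attach_in_trees_between[OF finite_block block_disjoint _ root] trees_on_block XY
      by (metis empty_iff insertI1)
  qed
  then show ?thesis by auto
qed

lemma splitting_out:
  assumes "X \<in> P" "(\<rho> X, v) \<in> parcs F"
  obtains Y where "(X, Y) \<in> parcs (splitting F P)" "v \<in> Y"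
proof -
  obtain Y where Y: "Y \<in> P" "v \<in> Y" using block_of in_arcsD2[OF assms(2)] by metis
  have "v \<notin> X" using leaving_arc_iff root_in assms by blast
  then show thesis using that Y assms splitting_arc_iff by blast
qed

lemma single_valued_splitting: "single_valued (parcs (splitting F P))"
proof (rule single_valuedI)
  fix X Y Z assume "(X, Y) \<in> parcs (splitting F P)" "(X, Z) \<in> parcs (splitting F P)"
  then obtain v w where "Y \<in> P" "Z \<in> P" "v \<in> Y" "w \<in> Z" "(\<rho> X, v) \<in> parcs F" "(\<rho> X, w) \<in> parcs F"
    unfolding splitting_arc_iff by blast
  then show "Y = Z" using sv block_disjoint by (metis disjoint_iff single_valuedD)
qed

section \<open>Acyclicity and sinks under contraction of the blocks\<close>

lemma reach_root:
  assumes "X \<in> P" "i \<in> X"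
  shows "(i, \<rho> X) \<in> (parcs F)\<^sup>*"
proof -
  obtain r where "r \<in> sinks (pinduce F X)" "(i, r) \<in> (parcs (pinduce F X))\<^sup>*"
    using ex_sink[OF entering_forest_block[OF assms(1)], of i] finite_block assms by auto
  moreover have "(parcs (pinduce F X))\<^sup>* \<subseteq> (parcs F)\<^sup>*" by (rule rtrancl_mono) auto
  ultimately show ?thesis using root[OF assms(1)] by auto
qed

text \<open>An arc of the splitting lifts to the arc leaving \<open>\<rho> X\<close>, followed by
  the path from its head to \<open>\<rho> Y\<close>.\<close>

lemma splitting_trancl:
  assumes "(X, Y) \<in> (parcs (splitting F P))\<^sup>+"
  shows "(\<rho> X, \<rho> Y) \<in> (parcs F)\<^sup>+"
proof -
  have step: "(\<rho> X, \<rho> Y) \<in> (parcs F)\<^sup>+" if "(X, Y) \<in> parcs (splitting F P)" for X Y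
    using that reach_root unfolding splitting_arc_iff by (meson rtrancl_into_trancl2)
  from assms show ?thesis
    by (induction rule: trancl_induct) (auto intro: step trancl_trans simp del: splitting_simps)
qed

text \<open>A walk stays in its first block until it leaves through the root; from then on the
  blocks visited trace a walk of the splitting. The second alternative includes
  \<open>Y = X\<close>: leaving \<open>X\<close> and coming back yields a cycle of the
  splitting.\<close>

lemma trancl_cases:
  assumes "(i, j) \<in> (parcs F)\<^sup>+" "X \<in> P" "i \<in> X"
  shows "j \<in> X \<and> (i, j) \<in> (parcs (pinduce F X))\<^sup>+ \<or>
    (\<exists>Y. (X, Y) \<in> (parcs (splitting F P))\<^sup>+ \<and> j \<in> Y \<and> Y \<in> P)"
  using assms(1)
proof (induction rule: trancl_induct)
  case (base j)
  show ?case
  proof (cases "j \<in> X")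
    case True
    then show ?thesis using base assms by auto
  next
    case False
    then have "i = \<rho> X" using leaving_arc_iff assms base by blast
    then obtain Y where "(X, Y) \<in> parcs (splitting F P)" "j \<in> Y"
      using splitting_out assms(2) base by metis
    then show ?thesis using splitting_arc_iff by blast
  qed
next
  case (step j l)
  have one: "l \<in> Y \<or> (\<exists>Z. (Y, Z) \<in> parcs (splitting F P) \<and> l \<in> Z \<and> Z \<in> P)"
    if "Y \<in> P" "j \<in> Y" for Y
  proof (cases "l \<in> Y")
    case False
    then have "j = \<rho> Y" using leaving_arc_iff that step.hyps by blast
    then show ?thesis using splitting_out[of Y l] that step.hyps splitting_arc_iff by metis
  qed simp
  from step.IH show ?case
  proof (elim disjE conjE exE)
    assume j: "j \<in> X" "(i, j) \<in> (parcs (pinduce F X))\<^sup>+"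
    show ?thesis
    proof (cases "l \<in> X")
      case True
      then have "(j, l) \<in> parcs (pinduce F X)" using j(1) step.hyps by simp
      then show ?thesis using True j(2) by (meson trancl_into_trancl)
    next
      case False
      then show ?thesis using one[OF assms(2) j(1)] by blast
    qed
  next
    fix Y assume "(X, Y) \<in> (parcs (splitting F P))\<^sup>+" "j \<in> Y" "Y \<in> P"
    then show ?thesis using one by (meson trancl_into_trancl)
  qed
qed

text \<open>Cycles of the splitting lift by \<open>splitting_trancl\<close>. Conversely, by
  \<open>trancl_cases\<close> a cycle of \<open>F\<close> either stays in one block, which
  \<open>ac_block\<close> excludes, or projects to a cycle of the splitting.\<close>

lemma acyclic_iff_splitting: "acyclic (parcs F) \<longleftrightarrow> acyclic (parcs (splitting F P))"
proof
  assume "acyclic (parcs F)"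
  then show "acyclic (parcs (splitting F P))"
    using splitting_trancl unfolding acyclic_def by blast
next
  assume ac: "acyclic (parcs (splitting F P))"
  have False if ii: "(i, i) \<in> (parcs F)\<^sup>+" for i
  proof -
    have "i \<in> pverts F" using ii wellformed' by (metis tranclD)
    then obtain X where X: "X \<in> P" "i \<in> X" by (rule block_of)
    from trancl_cases[OF ii X] show False
    proof (elim disjE conjE exE)
      assume "(i, i) \<in> (parcs (pinduce F X))\<^sup>+"
      then show False using ac_block[OF X(1)] unfolding acyclic_def by blast
    next
      fix Y assume Y: "(X, Y) \<in> (parcs (splitting F P))\<^sup>+" "i \<in> Y" "Y \<in> P"
      then have "X = Y" using X block_disjoint by blast
      then show False using Y(1) ac unfolding acyclic_def by blast
    qed
  qed
  then show "acyclic (parcs F)" unfolding acyclic_def by blast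
qed

lemma entering_forest_iff_splitting: "entering_forest F \<longleftrightarrow> entering_forest (splitting F P)"
  using acyclic_iff_splitting single_valued_splitting sv pair_wf_digraph_axioms
    pair_wf_digraph_splitting[of F P]
  by (simp add: entering_forest_iff del: splitting_simps)

text \<open>\<open>\<rho>\<close> is a bijection between the two sets of sinks: a sink of
  \<open>F\<close> must be the root of its block, and a root is a sink exactly when no arc leaves
  its block.\<close>

lemma card_sinks_splitting: "card (sinks (splitting F P)) = card (sinks F)"
proof -
  have "inj_on \<rho> (sinks (splitting F P))"
    using root_in block_disjoint by (intro inj_onI) (metis disjoint_iff sinks_subset splitting_simps(1) subsetD)
  moreover have "\<rho> ` sinks (splitting F P) = sinks F"
  proof (intro equalityI subsetI)
    fix r assume "r \<in> \<rho> ` sinks (splitting F P)"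
    then obtain X where X: "X \<in> P" "r = \<rho> X" "\<And>Y. (X, Y) \<notin> parcs (splitting F P)"
      by (auto simp: sinks_def)
    then have "(r, v) \<notin> parcs F" for v using splitting_out by metis
    then show "r \<in> sinks F"
      using X root_in[OF X(1)] block_subset[OF X(1)] by (auto simp: sinks_def)
  next
    fix r assume r: "r \<in> sinks F"
    then have "r \<in> pverts F" by (simp add: sinks_def)
    then obtain X where X: "X \<in> P" "r \<in> X" by (rule block_of)
    then have "r = \<rho> X" using not_root_arc[OF X] r by (auto simp: sinks_def)
    moreover have "X \<in> sinks (splitting F P)"
      using X r splitting_arc_iff[of X] \<open>r = \<rho> X\<close> by (simp add: sinks_def del: splitting_simps(2))
    ultimately show "r \<in> \<rho> ` sinks (splitting F P)" by blast
  qed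
  ultimately show ?thesis by (metis card_image)
qed

section \<open>Weights of \<open>F\<close> and of its splitting on a single block\<close>

lemma weight_from_sink:
  assumes "X \<in> sinks (splitting F P)"
  shows "weight_from \<psi> X F = weight \<psi> (pinduce F X)"
    and "weight_from \<phi> {X} (splitting F P) = 0"
proof -
  have X: "X \<in> P" using assms sinks_subset by fastforce
  have "(\<rho> X, v) \<notin> parcs F" for v
    using assms splitting_out[OF X] by (metis (no_types, lifting) mem_Collect_eq sinks_def)
  then have "{e \<in> parcs F. fst e \<in> X} = parcs (pinduce F X)"
    using leaving_arc_iff[OF X] by fastforce
  then show "weight_from \<psi> X F = weight \<psi> (pinduce F X)"
    by (simp add: weight_eq_sum[OF pair_wf_digraph_pinduce] weight_from_def)
  have "{e \<in> parcs (splitting F P). fst e \<in> {X}} = {}" using assms by (auto simp: sinks_def)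
  then show "weight_from \<phi> {X} (splitting F P) = 0"
    unfolding weight_from_def by (simp only: sum.empty)
qed

text \<open>The arc at the root is the only one leaving the block, so the arcs starting in
  \<open>X\<close> form the induced tree extended by that arc.\<close>

lemma weight_from_arc:
  assumes XY: "(X, Y) \<in> parcs (splitting F P)" and v: "(\<rho> X, v) \<in> parcs F"
  shows "weight_from \<psi> X F = weight \<psi> (attach (pinduce F X) (\<rho> X, v))"
    and "weight_from \<phi> {X} (splitting F P) = \<phi> (X, Y)"
proof -
  have X: "X \<in> P" using XY by simp
  have "{e \<in> parcs F. fst e \<in> X} = parcs (attach (pinduce F X) (\<rho> X, v))"
    using leaving_arc_iff[OF X] v root_in[OF X] sv by (fastforce dest: single_valuedD)
  moreover have "pair_wf_digraph (attach (pinduce F X) (\<rho> X, v))"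
    using root_in[OF X] by unfold_locales auto
  ultimately show "weight_from \<psi> X F = weight \<psi> (attach (pinduce F X) (\<rho> X, v))"
    by (simp add: weight_eq_sum weight_from_def)
  have "{e \<in> parcs (splitting F P). fst e \<in> {X}} = {(X, Y)}"
    using XY single_valued_splitting by (auto simp del: splitting_simps dest: single_valuedD)
  then show "weight_from \<phi> {X} (splitting F P) = \<phi> (X, Y)"
    unfolding weight_from_def by (simp del: splitting_simps)
qed

end

section \<open>Contracting tree-divisible forests\<close>

lemma divisible_forest_tree_blocks:
  assumes "entering_forest F" "finite (pverts F)" "partition_on (pverts F) P" "tree_divisible F P"
  obtains \<rho> where "tree_blocks F P \<rho>"
proof -
  have wf: "pair_wf_digraph F" and sv: "single_valued (parcs F)" and ac: "acyclic (parcs F)"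
    using assms(1) by (auto simp: entering_forest_iff)
  have "\<exists>r. sinks (pinduce F X) = {r}" if X: "X \<in> P" for X
  proof -
    have "X \<subseteq> pverts F" using partition_onD1[OF assms(3)] X by blast
    then have fX: "finite X" using assms(2) finite_subset by blast
    obtain S where S: "S \<in> trees_on F X" using assms(4) X by (auto simp: tree_divisible_def)
    then have ef: "entering_forest S" by (simp add: trees_on_def entering_tree_def)
    obtain r where r: "sinks S = {r}" "r \<in> X" "pverts S = X" "parcs S \<subseteq> parcs F"
      "parcs S \<subseteq> X \<times> X"
      by (rule trees_onE[OF S fX])
    \<comment> \<open>An arc of \<open>F\<close> from the root of \<open>S\<close> back into
      \<open>X\<close> would close a cycle with the path of \<open>S\<close> from its head to the
      root. Hence the root of \<open>S\<close> is a sink of the whole induced graph, not just of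
      \<open>S\<close>.\<close>
    have "(r, w) \<notin> parcs F" if "w \<in> X" for w
    proof
      assume rw: "(r, w) \<in> parcs F"
      have "(w, r) \<in> (parcs S)\<^sup>*" using ex_sink[OF ef] fX that r(1,3) by auto
      then have "(w, r) \<in> (parcs F)\<^sup>*" using rtrancl_mono[OF r(4)] by blast
      with rw have "(r, r) \<in> (parcs F)\<^sup>+" by simp
      then show False using ac by (auto simp: acyclic_def)
    qed
    then have "r \<in> sinks (pinduce F X)" using r(2) by (auto simp: sinks_def)
    moreover have "sinks (pinduce F X) \<subseteq> sinks S" using r(3-5) by (auto simp: sinks_def)
    ultimately show ?thesis using r(1) by blast
  qed
  then obtain \<rho> where "\<forall>X \<in> P. sinks (pinduce F X) = {\<rho> X}" by metis
  then have "tree_blocks F P \<rho>"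
    using wf assms(2,3) sv entering_forest_pinduce[OF assms(1)]
    by (auto simp: tree_blocks_def tree_blocks_axioms_def entering_forest_iff)
  then show thesis by (rule that)
qed

lemma spanning_forestsE:
  assumes "F \<in> spanning_forests k G" "finite (pverts G)"
  shows "pverts F = pverts G" "entering_forest F" "subgraph (with_proj F) (with_proj G)"
    "card (sinks F) = k"
  using assms card_components[of F] by (auto simp: spanning_forests_def spanning_def)

lemma spanning_forestsI:
  assumes "finite (pverts G)" "pverts F = pverts G" "entering_forest F"
    "subgraph (with_proj F) (with_proj G)" "card (sinks F) = k"
  shows "F \<in> spanning_forests k G"
  using assms card_components[of F] by (auto simp: spanning_forests_def spanning_def)

text \<open>Being a forest and the number of trees transfer through \<open>tree_blocks\<close>; the
  arcs of the splitting are inherited because trees between blocks in \<open>F\<close> are also such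
  trees in \<open>\<Psi>\<close>.\<close>

lemma splitting_in_spanning_forests:
  assumes "finite (pverts \<Psi>)" "partition_on (pverts \<Psi>) P"
    and F: "F \<in> spanning_forests k \<Psi>" "tree_divisible F P"
  shows "splitting F P \<in> spanning_forests k (splitting \<Psi> P)"
proof -
  note F' = spanning_forestsE[OF F(1) assms(1)]
  obtain \<rho> where "tree_blocks F P \<rho>"
    using divisible_forest_tree_blocks F' F(2) assms by metis
  then interpret tree_blocks F P \<rho> .
  show ?thesis
  proof (rule spanning_forestsI)
    show "finite (pverts (splitting \<Psi> P))"
      using finite_elements[OF assms(1,2)] by simp
    show "subgraph (with_proj (splitting F P)) (with_proj (splitting \<Psi> P))"
      using trees_between_mono[OF F'(3)] pair_wf_digraph_splitting
      by (fastforce simp: subgraph_with_proj_iff)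
  qed (use F' entering_forest_iff_splitting card_sinks_splitting in auto)
qed

section \<open>The lower bound for the weight of a divisible forest\<close>

context tree_blocks
begin

text \<open>If an arc leaves \<open>X\<close>, then \<open>min_tree_on\<close> cancels against the
  subtrahend in \<open>splitting_weight\<close>, and what remains is the minimum over trees from
  \<open>X\<close> to \<open>Y\<close>, one of which is cut out by \<open>F\<close>. Otherwise the
  splitting contributes 0 and the induced tree is compared with the minimal one.\<close>

lemma block_weight_ge:
  assumes "pair_fin_digraph \<Psi>" "subgraph (with_proj F) (with_proj \<Psi>)" "X \<in> P"
  shows "min_tree_on \<psi> \<Psi> X + weight_from (splitting_weight \<psi> \<Psi>) {X} (splitting F P)
    \<le> weight_from \<psi> X F"
proof (cases "X \<in> sinks (splitting F P)")
  case True
  have "pinduce F X \<in> trees_on F X" using trees_on_block[OF assms(3)] by simp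
  then have "pinduce F X \<in> trees_on \<Psi> X"
    using assms(2) by (auto simp: trees_on_def intro: subgraph_trans)
  then have "min_tree_on \<psi> \<Psi> X \<le> weight \<psi> (pinduce F X)"
    using finite_trees_on[OF assms(1)] by (simp add: min_tree_on_def)
  then show ?thesis using weight_from_sink[OF True] by simp
next
  case False
  then obtain Y where XY: "(X, Y) \<in> parcs (splitting F P)" using assms(3) by (auto simp: sinks_def)
  then obtain v where v: "v \<in> Y" "(\<rho> X, v) \<in> parcs F" "Y \<in> P" "X \<noteq> Y"
    unfolding splitting_arc_iff by blast
  have "attach (pinduce F X) (\<rho> X, v) \<in> trees_between F X Y"
    using attach_in_trees_between[OF finite_block block_disjoint _ root]
      trees_on_block assms(3) v by blast
  then have "attach (pinduce F X) (\<rho> X, v) \<in> trees_between \<Psi> X Y"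
    using trees_between_mono[OF assms(2)] by blast
  then have "min_tree_between \<psi> \<Psi> X Y \<le> weight \<psi> (attach (pinduce F X) (\<rho> X, v))"
    using finite_trees_between[OF assms(1)] by (simp add: min_tree_between_def)
  then show ?thesis
    unfolding weight_from_arc[OF XY v(2)] by (simp add: splitting_weight_def)
qed

lemma weight_eq_sum_P: "weight \<psi> F = (\<Sum>X\<in>P. weight_from \<psi> X F)"
  by (rule weight_eq_sum_blocks[OF pair_wf_digraph_axioms fin part])

end

lemma weight_ge_splitting:
  assumes "pair_fin_digraph \<Psi>" "partition_on (pverts \<Psi>) P"
    and F: "F \<in> spanning_forests k \<Psi>" "tree_divisible F P"
  shows "(\<Sum>X\<in>P. min_tree_on \<psi> \<Psi> X) + weight (splitting_weight \<psi> \<Psi>) (splitting F P) \<le> weight \<psi> F"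
proof -
  have finV: "finite (pverts \<Psi>)" by (rule pair_fin_digraph.pair_finite_verts[OF assms(1)])
  note F' = spanning_forestsE[OF F(1) finV]
  obtain \<rho> where "tree_blocks F P \<rho>"
    using divisible_forest_tree_blocks F' F(2) assms finV by metis
  then interpret tree_blocks F P \<rho> .
  have "finite P" by (rule finite_elements[OF finV assms(2)])
  then have "weight (splitting_weight \<psi> \<Psi>) (splitting F P) =
      (\<Sum>X\<in>P. weight_from (splitting_weight \<psi> \<Psi>) {X} (splitting F P))"
    using weight_eq_sum_vertices[OF pair_wf_digraph_splitting] by (metis splitting_simps(1))
  then show ?thesis
    using sum_mono[of P, OF block_weight_ge[OF assms(1) F'(3)]]
    by (simp add: weight_eq_sum_P sum.distrib)
qed

section \<open>Gluing optimal trees along a forest of the splitting\<close>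

lemma trees_on_min:
  assumes "pair_fin_digraph G" "trees_on G X \<noteq> {}"
  obtains S where "S \<in> trees_on G X" "weight \<psi> S = min_tree_on \<psi> G X"
proof -
  have "min_tree_on \<psi> G X \<in> weight \<psi> ` trees_on G X"
    using assms finite_trees_on unfolding min_tree_on_def by (intro Min_in) auto
  then show thesis using that by force
qed

lemma trees_between_min:
  assumes "pair_fin_digraph G" "trees_between G X Y \<noteq> {}"
  obtains T where "T \<in> trees_between G X Y" "weight \<psi> T = min_tree_between \<psi> G X Y"
proof -
  have "min_tree_between \<psi> G X Y \<in> weight \<psi> ` trees_between G X Y"
    using assms finite_trees_between unfolding min_tree_between_def by (intro Min_in) auto
  then show thesis using that by force
qed

text \<open>\<open>E\<close> holds the arc leaving the block, if there is one, so both cases share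
  one form. When \<open>X\<close> has an arc in \<open>H\<close>, an optimal tree between blocks is
  cut into \<open>S\<close> and its last arc; \<open>S\<close> alone need not be minimal on
  \<open>X\<close>, only the sum is optimal.\<close>

lemma optimal_block:
  assumes \<Psi>: "pair_fin_digraph \<Psi>" "partition_on (pverts \<Psi>) P" "tree_divisible \<Psi> P"
    and H: "subgraph (with_proj H) (with_proj (splitting \<Psi> P))" "single_valued (parcs H)"
    and X: "X \<in> P"
  obtains S r E where "S \<in> trees_on \<Psi> X" "sinks S = {r}" "E \<subseteq> parcs \<Psi>" "E \<subseteq> {r} \<times> \<Union> (parcs H `` {X})"
    "single_valued E" "\<And>Y. (X, Y) \<in> parcs H \<Longrightarrow> \<exists>v \<in> Y. (r, v) \<in> E"
    "sum \<psi> (parcs S \<union> E) = min_tree_on \<psi> \<Psi> X + weight_from (splitting_weight \<psi> \<Psi>) {X} H"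
proof -
  have "X \<subseteq> pverts \<Psi>" using partition_onD1[OF \<Psi>(2)] X by blast
  then have fX: "finite X"
    using pair_fin_digraph.pair_finite_verts[OF \<Psi>(1)] finite_subset by blast
  show thesis
  proof (cases "\<exists>Y. (X, Y) \<in> parcs H")
    case False
    obtain S where S: "S \<in> trees_on \<Psi> X" "weight \<psi> S = min_tree_on \<psi> \<Psi> X"
      using trees_on_min[OF \<Psi>(1)] \<Psi>(3) X unfolding tree_divisible_def by metis
    obtain r where r: "sinks S = {r}" "pair_wf_digraph S" using trees_onE[OF S(1) fX] by metis
    have "{e \<in> parcs H. fst e \<in> {X}} = {}" using False by auto
    then have "weight_from (splitting_weight \<psi> \<Psi>) {X} H = 0"
      unfolding weight_from_def by (simp only: sum.empty)
    then have "sum \<psi> (parcs S \<union> {}) = min_tree_on \<psi> \<Psi> X + weight_from (splitting_weight \<psi> \<Psi>) {X} H"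
      using S(2) weight_eq_sum[OF r(2)] by simp
    then show thesis using that[OF S(1) r(1), of "{}"] False by auto
  next
    case True
    then obtain Y where XY: "(X, Y) \<in> parcs H" ..
    then have Y: "Y \<in> P" "X \<noteq> Y" "trees_between \<Psi> X Y \<noteq> {}"
      using H(1) by (auto simp: subgraph_with_proj_iff)
    have disj: "X \<inter> Y = {}" using \<Psi>(2) X Y by (auto simp: partition_on_def disjoint_def)
    obtain T where T: "T \<in> trees_between \<Psi> X Y" "weight \<psi> T = min_tree_between \<psi> \<Psi> X Y"
      using trees_between_min[OF \<Psi>(1) Y(3)] by metis
    obtain S r v where S: "S \<in> trees_on \<Psi> X" "sinks S = {r}" "v \<in> Y" "(r, v) \<in> parcs \<Psi>"
      "T = attach S (r, v)"
      using trees_betweenE[OF T(1) fX disj] .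
    have "pair_wf_digraph T"
      using T(1) by (auto simp: trees_between_def trees_beyond_def subgraph_with_proj_iff)
    then have wT: "sum \<psi> (parcs S \<union> {(r, v)}) = min_tree_between \<psi> \<Psi> X Y"
      using T(2) S(5) by (simp add: weight_eq_sum)
    have only: "Z = Y" if "(X, Z) \<in> parcs H" for Z using that XY H(2) by (auto dest: single_valuedD)
    have "{e \<in> parcs H. fst e \<in> {X}} = {(X, Y)}" using XY by (auto dest: only)
    then have "weight_from (splitting_weight \<psi> \<Psi>) {X} H
        = min_tree_between \<psi> \<Psi> X Y - min_tree_on \<psi> \<Psi> X"
      unfolding weight_from_def splitting_weight_def by simp
    then show thesis
      using that[OF S(1,2), of "{(r, v)}"] S(3,4) wT XY by (auto simp: single_valued_def dest: only)
  qed
qed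

text \<open>The union of the pieces from \<open>optimal_block\<close> induces the chosen tree on
  each block and contracts to \<open>H\<close>, so it inherits from \<open>H\<close> both acyclicity
  and the number of trees.\<close>

lemma optimal_principal:
  assumes \<Psi>: "pair_fin_digraph \<Psi>" "partition_on (pverts \<Psi>) P" "tree_divisible \<Psi> P"
    and H: "H \<in> spanning_forests k (splitting \<Psi> P)"
  obtains F where "F \<in> spanning_forests k \<Psi>" "tree_divisible F P" "splitting F P = H"
    "weight \<psi> F = (\<Sum>X\<in>P. min_tree_on \<psi> \<Psi> X) + weight (splitting_weight \<psi> \<Psi>) H"
proof -
  have finV: "finite (pverts \<Psi>)" by (rule pair_fin_digraph.pair_finite_verts[OF \<Psi>(1)])
  have wf\<Psi>: "pair_wf_digraph \<Psi>" using \<Psi>(1) by (simp add: pair_fin_digraph_def)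
  have finP: "finite P" by (rule finite_elements[OF finV \<Psi>(2)])
  have H': "pverts H = P" "entering_forest H" "subgraph (with_proj H) (with_proj (splitting \<Psi> P))"
    "card (sinks H) = k"
    using spanning_forestsE[OF H] finP by auto
  have svH: "single_valued (parcs H)" and wfH: "pair_wf_digraph H"
    using H'(2) by (auto simp: entering_forest_iff)
  have fX: "finite X" if "X \<in> P" for X
    using partition_onD1[OF \<Psi>(2)] that finV by (metis Sup_upper finite_subset)
  have disj: "X = Y" if "X \<in> P" "Y \<in> P" "i \<in> X" "i \<in> Y" for X Y i
    using \<Psi>(2) that by (auto simp: partition_on_def disjoint_def)
  have HP: "X \<in> P" "Y \<in> P" "X \<noteq> Y" if "(X, Y) \<in> parcs H" for X Y
    using that H'(3) by (auto simp: subgraph_with_proj_iff)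
  have "\<forall>X \<in> P. \<exists>S r E. S \<in> trees_on \<Psi> X \<and> sinks S = {r} \<and> E \<subseteq> parcs \<Psi> \<and>
      E \<subseteq> {r} \<times> \<Union> (parcs H `` {X}) \<and> single_valued E \<and>
      (\<forall>Y. (X, Y) \<in> parcs H \<longrightarrow> (\<exists>v \<in> Y. (r, v) \<in> E)) \<and>
      sum \<psi> (parcs S \<union> E) = min_tree_on \<psi> \<Psi> X + weight_from (splitting_weight \<psi> \<Psi>) {X} H"
    using optimal_block[OF \<Psi> H'(3) svH] by (metis (no_types, lifting))
  then obtain S r E where "\<forall>X \<in> P. S X \<in> trees_on \<Psi> X \<and> sinks (S X) = {r X} \<and> E X \<subseteq> parcs \<Psi> \<and>
      E X \<subseteq> {r X} \<times> \<Union> (parcs H `` {X}) \<and> single_valued (E X) \<and>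
      (\<forall>Y. (X, Y) \<in> parcs H \<longrightarrow> (\<exists>v \<in> Y. (r X, v) \<in> E X)) \<and>
      sum \<psi> (parcs (S X) \<union> E X) = min_tree_on \<psi> \<Psi> X + weight_from (splitting_weight \<psi> \<Psi>) {X} H"
    by metis
  then have S: "\<And>X. X \<in> P \<Longrightarrow> S X \<in> trees_on \<Psi> X" "\<And>X. X \<in> P \<Longrightarrow> sinks (S X) = {r X}"
    and E: "\<And>X. X \<in> P \<Longrightarrow> E X \<subseteq> parcs \<Psi>" "\<And>X. X \<in> P \<Longrightarrow> E X \<subseteq> {r X} \<times> \<Union> (parcs H `` {X})"
      "\<And>X. X \<in> P \<Longrightarrow> single_valued (E X)"
      "\<And>X Y. (X, Y) \<in> parcs H \<Longrightarrow> \<exists>v \<in> Y. (r X, v) \<in> E X"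
    and w: "\<And>X. X \<in> P \<Longrightarrow> sum \<psi> (parcs (S X) \<union> E X) =
      min_tree_on \<psi> \<Psi> X + weight_from (splitting_weight \<psi> \<Psi>) {X} H"
    using HP by blast+
  have S': "r X \<in> X" "pverts (S X) = X" "parcs (S X) \<subseteq> parcs \<Psi>" "parcs (S X) \<subseteq> X \<times> X"
    "single_valued (parcs (S X))" "acyclic (parcs (S X))" if "X \<in> P" for X
    using trees_onE[OF S(1)[OF that] fX[OF that]] S(2)[OF that] by (metis singleton_inject)+
  have noroot: "(r X, j) \<notin> parcs (S X)" if "X \<in> P" for X j
    using S(2)[OF that] by (auto simp: sinks_def)
  \<comment> \<open>The head lies in a block that is a successor of \<open>X\<close> in
    \<open>H\<close>; this block differs from \<open>X\<close>, as the splitting has no loops, and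
    so is disjoint from it.\<close>
  have Eout: "i = r X \<and> j \<notin> X \<and> (\<exists>Y. (X, Y) \<in> parcs H \<and> j \<in> Y)"
    if X: "X \<in> P" and ij: "(i, j) \<in> E X" for X i j
  proof -
    obtain Y where Y: "(X, Y) \<in> parcs H" "j \<in> Y" "i = r X" using E(2)[OF X] ij by blast
    then show ?thesis using HP[OF Y(1)] disj by blast
  qed
  define F where "F = \<lparr>pverts = pverts \<Psi>, parcs = (\<Union>X\<in>P. parcs (S X) \<union> E X)\<rparr>"
  have F_simps: "pverts F = pverts \<Psi>" "parcs F = (\<Union>X\<in>P. parcs (S X) \<union> E X)"
    by (simp_all add: F_def)
  \<comment> \<open>All arcs contributed by a block have their tails in that block, so the tail of
    an arc determines the piece it belongs to.\<close>
  have FX: "(i, j) \<in> parcs F \<longleftrightarrow> (i, j) \<in> parcs (S X) \<union> E X" if "X \<in> P" "i \<in> X" for X i j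
  proof
    assume "(i, j) \<in> parcs F"
    then obtain Z where Z: "Z \<in> P" "(i, j) \<in> parcs (S Z) \<union> E Z" by (auto simp: F_simps)
    then have "i \<in> Z" using S'(1,4)[OF Z(1)] Eout[OF Z(1)] by blast
    then show "(i, j) \<in> parcs (S X) \<union> E X" using disj that Z by blast
  qed (use that in \<open>auto simp: F_simps\<close>)
  have "parcs F \<subseteq> parcs \<Psi>" using S'(3) E(1) by (auto simp: F_simps)
  then have wfF: "pair_wf_digraph F"
    using wf\<Psi> by (auto simp: pair_wf_digraph_def F_simps(1))
  have sub: "subgraph (with_proj F) (with_proj \<Psi>)"
    using \<open>parcs F \<subseteq> parcs \<Psi>\<close> wfF wf\<Psi> by (simp add: subgraph_with_proj_iff F_simps(1))
  have ind: "pinduce F X = S X" if "X \<in> P" for X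
    using FX[OF that] S'(2,4)[OF that] Eout[OF that]
    by (auto intro!: pair_pre_digraph.equality)
  have svF: "single_valued (parcs F)"
  proof (rule single_valuedI)
    fix i j l assume ij: "(i, j) \<in> parcs F" and il: "(i, l) \<in> parcs F"
    then have "i \<in> pverts \<Psi>" using wfF F_simps(1) pair_wf_digraph.in_arcsD1 by metis
    then obtain X where X: "X \<in> P" "i \<in> X" using partition_onD1[OF \<Psi>(2)] by blast
    show "j = l"
      using ij il FX[OF X] S'(5)[OF X(1)] E(3)[OF X(1)] noroot[OF X(1)] Eout[OF X(1)]
      by (auto dest: single_valuedD)
  qed
  \<comment> \<open>Only the blocks are known to be acyclic at this point; that \<open>F\<close> is
    a forest follows below from \<open>H\<close> by
    \<open>entering_forest_iff_splitting\<close>.\<close>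
  interpret tree_blocks F P r
    using wfF finV \<Psi>(2) svF S(2) S'(6)
    by (simp add: tree_blocks_def tree_blocks_axioms_def F_simps(1) ind del: pinduce_simps)
  have "parcs (splitting F P) = parcs H"
  proof (intro equalityI subrelI)
    fix X Y assume "(X, Y) \<in> parcs (splitting F P)"
    then obtain v where v: "X \<in> P" "Y \<in> P" "v \<in> Y" "(r X, v) \<in> parcs F"
      unfolding splitting_arc_iff by blast
    then have "(r X, v) \<in> E X" using FX S'(1) noroot by blast
    then obtain Z where "(X, Z) \<in> parcs H" "v \<in> Z" using Eout v(1) by blast
    then show "(X, Y) \<in> parcs H" using disj HP v by blast
  next
    fix X Y assume XY: "(X, Y) \<in> parcs H"
    then obtain v where "v \<in> Y" "(r X, v) \<in> E X" using E(4) by blast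
    then show "(X, Y) \<in> parcs (splitting F P)"
      unfolding splitting_arc_iff using HP[OF XY] FX S'(1) by blast
  qed
  then have split: "splitting F P = H" using H'(1) by (intro pair_pre_digraph.equality) auto
  have "weight_from \<psi> X F = min_tree_on \<psi> \<Psi> X + weight_from (splitting_weight \<psi> \<Psi>) {X} H"
    if "X \<in> P" for X
  proof -
    have "{e \<in> parcs F. fst e \<in> X} = parcs (S X) \<union> E X"
      using FX[OF that] S'(1,4)[OF that] Eout[OF that] by auto
    then show ?thesis using w[OF that] by (simp add: weight_from_def)
  qed
  moreover have "weight (splitting_weight \<psi> \<Psi>) H = (\<Sum>X\<in>P. weight_from (splitting_weight \<psi> \<Psi>) {X} H)"
    using weight_eq_sum_vertices[OF wfH] H'(1) finP by simp
  ultimately have wF: "weight \<psi> F = (\<Sum>X\<in>P. min_tree_on \<psi> \<Psi> X) + weight (splitting_weight \<psi> \<Psi>) H"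
    by (simp add: weight_eq_sum_P sum.distrib)
  have "F \<in> spanning_forests k \<Psi>"
    using finV F_simps(1) sub entering_forest_iff_splitting card_sinks_splitting split H'(2,4)
    by (intro spanning_forestsI) auto
  moreover have "tree_divisible F P" using trees_on_block by (simp add: tree_divisible_def)
  ultimately show thesis using that split wF by blast
qed

theorem theorem3:
  fixes \<Psi> :: "'a pair_pre_digraph" and \<psi> :: "('a \<times> 'a) weight_fun"
    and P :: "'a set set" and k :: nat
    and F :: "'a pair_pre_digraph" and F' :: "'a set pair_pre_digraph"
  assumes "pair_fin_digraph \<Psi>"
    and "partition_on (pverts \<Psi>) P"
    and "tree_divisible \<Psi> P"
    and "F' \<in> spanning_forests k (splitting \<Psi> P)"
    and "F \<in> min_weight_in \<psi> (principals \<Psi> P F')"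
  shows "F \<in> min_weight_in \<psi> (divisible_forests k \<Psi> P) \<longleftrightarrow>
    F' \<in> min_weight_in (splitting_weight \<psi> \<Psi>) (spanning_forests k (splitting \<Psi> P))"
proof -
  let ?c = "\<Sum>X\<in>P. min_tree_on \<psi> \<Psi> X" and ?w = "weight (splitting_weight \<psi> \<Psi>)"
  have finV: "finite (pverts \<Psi>)" by (rule pair_fin_digraph.pair_finite_verts[OF assms(1)])
  then have finP: "finite (pverts (splitting \<Psi> P))" using finite_elements[OF _ assms(2)] by simp
  obtain k' where F: "F \<in> spanning_forests k' \<Psi>" "tree_divisible F P"
    and arcs: "parcs F' = parcs (splitting F P)"
    and minF: "\<And>K. K \<in> principals \<Psi> P F' \<Longrightarrow> weight \<psi> F \<le> weight \<psi> K"
    using assms(5) unfolding min_weight_in_def is_arg_min_linorder principals_def by blast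
  have split: "splitting F P = F'"
    using arcs spanning_forestsE(1)[OF assms(4) finP] by (intro pair_pre_digraph.equality) auto
  \<comment> \<open>A principal may have any number of trees by definition; since contraction
    preserves this number, \<open>k'\<close> is forced to be \<open>k\<close>.\<close>
  have "F' \<in> spanning_forests k' (splitting \<Psi> P)"
    using splitting_in_spanning_forests[OF finV assms(2) F] split by simp
  then have "k' = k" using assms(4) by (simp add: spanning_forests_def)
  then have Fk: "F \<in> divisible_forests k \<Psi> P" using F by (simp add: divisible_forests_def)
  \<comment> \<open>The lower bound is attained by some principal \<open>K\<close> of
    \<open>F'\<close>, and \<open>F\<close> is no heavier than \<open>K\<close>.\<close>
  have wF: "weight \<psi> F = ?c + ?w F'"
  proof (rule antisym)
    show "?c + ?w F' \<le> weight \<psi> F"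
      using weight_ge_splitting[OF assms(1,2) F] split by metis
    obtain K where "K \<in> spanning_forests k \<Psi>" "tree_divisible K P" "splitting K P = F'"
      "weight \<psi> K = ?c + ?w F'"
      using optimal_principal[OF assms(1-4)] by metis
    then show "weight \<psi> F \<le> ?c + ?w F'" using minF by (force simp: principals_def)
  qed
  show ?thesis
  proof
    assume "F \<in> min_weight_in \<psi> (divisible_forests k \<Psi> P)"
    then have min: "weight \<psi> F \<le> weight \<psi> K" if "K \<in> divisible_forests k \<Psi> P" for K
      using that by (simp add: min_weight_in_def is_arg_min_linorder)
    \<comment> \<open>A competitor \<open>H\<close> is lifted to a divisible forest heavier than it
      by exactly \<open>?c\<close>, the same offset as between \<open>F\<close> and
      \<open>F'\<close>.\<close>
    have "?w F' \<le> ?w H" if H: "H \<in> spanning_forests k (splitting \<Psi> P)" for H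
    proof -
      obtain K where "K \<in> spanning_forests k \<Psi>" "tree_divisible K P" "weight \<psi> K = ?c + ?w H"
        using optimal_principal[OF assms(1-3) H] by metis
      then show ?thesis using min[of K] wF by (simp add: divisible_forests_def)
    qed
    then show "F' \<in> min_weight_in (splitting_weight \<psi> \<Psi>) (spanning_forests k (splitting \<Psi> P))"
      using assms(4) by (simp add: min_weight_in_def is_arg_min_linorder)
  next
    assume "F' \<in> min_weight_in (splitting_weight \<psi> \<Psi>) (spanning_forests k (splitting \<Psi> P))"
    then have min: "?w F' \<le> ?w H" if "H \<in> spanning_forests k (splitting \<Psi> P)" for H
      using that by (simp add: min_weight_in_def is_arg_min_linorder)
    \<comment> \<open>\<open>K\<close> need not be a minimal principal of its own splitting, so only
      the inequality \<open>weight_ge_splitting\<close> is available for it; it points in the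
      required direction.\<close>
    have "weight \<psi> F \<le> weight \<psi> K" if "K \<in> divisible_forests k \<Psi> P" for K
    proof -
      have K: "K \<in> spanning_forests k \<Psi>" "tree_divisible K P"
        using that by (auto simp: divisible_forests_def)
      have "?w F' \<le> ?w (splitting K P)"
        by (rule min[OF splitting_in_spanning_forests[OF finV assms(2) K]])
      then show ?thesis
        using weight_ge_splitting[OF assms(1,2) K, of \<psi>] wF by linarith
    qed
    then show "F \<in> min_weight_in \<psi> (divisible_forests k \<Psi> P)"
      using Fk by (simp add: min_weight_in_def is_arg_min_linorder)
  qed
qed

end
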